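(* Let $V$ be a real vector space paired with a dual vector space $V^*$ by $\langle\cdot,\cdot\rangle$, let $U\subset V$ be convex, and let $G\colon U\to\mathbb{R}$ be convex. Let $X$ be a $U$-valued random variable with support $\mathcal{X}$ such that $\mathbb{E}[X]\in U$ and $\mathbb{E}[G(X)]$ exist and $G$ has a subgradient (e.g. the gradient, if $G$ is differentiable) at $\mathbb{E}[X]$, used to define $d_G(\mathbb{E}[X],\cdot)$. For $\alpha\in(0,1)$ put $$\mathrm{CR}_{(1-\alpha)}=\left\{x\in\mathcal{X}\;\middle|\;d_G\left(\mathbb{E}[X],x\right)\le\frac{\mathbb{B}_G[X]}{\alpha}\right\}.$$ Then $\mathrm{CR}_{(1-\alpha)}$ is a $(1-\alpha)\cdot100\%$-confidence region for $X$, i.e. $\mathbb{P}\left(X\in\mathrm{CR}_{(1-\alpha)}\right)\ge1-\alpha$.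
   Context: $d_G(x,y)=G(y)-G(x)-\langle g,y-x\rangle$ is the (functional) Bregman divergence, where $g\in V^*$ is the chosen subgradient of $G$ at $x$, i.e. $G(y)\ge G(x)+\langle g,y-x\rangle$ for all $y\in U$. $\mathbb{B}_G[X]=\mathbb{E}[G(X)]-G(\mathbb{E}[X])$ is the (functional) Bregman Information. The expectation satisfies $\langle g,\mathbb{E}[X]\rangle=\mathbb{E}\left[\langle g,X\rangle\right]$. The support $\mathcal{X}\subset U$ is a set with $X\in\mathcal{X}$ almost surely. *)

theory Defs
  imports "HOL-Probability.Probability"
begin

text \<open>
  Throughout, \<open>pair :: 'w \<Rightarrow> 'v \<Rightarrow> real\<close> is the duality pairing, with the element of \<open>V\<^sup>*\<close> as
  first argument. A function \<open>G\<close> on \<open>U\<close> is a total function whose values outside \<open>U\<close> are never used.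
\<close>

definition is_subgradient ::
    "('w \<Rightarrow> 'v::real_vector \<Rightarrow> real) \<Rightarrow> 'v set \<Rightarrow> ('v \<Rightarrow> real) \<Rightarrow> 'v \<Rightarrow> 'w \<Rightarrow> bool" where
  "is_subgradient pair U G x g \<longleftrightarrow> x \<in> U \<and> (\<forall>y\<in>U. G y \<ge> G x + pair g (y - x))"

definition bregman_div ::
    "('w \<Rightarrow> 'v::real_vector \<Rightarrow> real) \<Rightarrow> ('v \<Rightarrow> real) \<Rightarrow> 'w \<Rightarrow> 'v \<Rightarrow> 'v \<Rightarrow> real" where
  "bregman_div pair G g x y = G y - G x - pair g (y - x)"

text \<open>
  \<open>V\<close> carries no topology, so the expectation of a \<open>V\<close>-valued random variable is understood in the
  weak (Pettis) sense with respect to the pairing.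
\<close>

definition has_weak_expectation ::
    "('w \<Rightarrow> 'v \<Rightarrow> real) \<Rightarrow> 'a measure \<Rightarrow> ('a \<Rightarrow> 'v) \<Rightarrow> 'v \<Rightarrow> bool" where
  "has_weak_expectation pair M X m \<longleftrightarrow>
     (\<forall>g. integrable M (\<lambda>\<omega>. pair g (X \<omega>)) \<and> pair g m = (\<integral>\<omega>. pair g (X \<omega>) \<partial>M))"

text \<open>In the next two definitions \<open>m\<close> stands for the expectation of \<open>X\<close>.\<close>

definition bregman_info ::
    "'a measure \<Rightarrow> ('v \<Rightarrow> real) \<Rightarrow> ('a \<Rightarrow> 'v) \<Rightarrow> 'v \<Rightarrow> real" where
  "bregman_info M G X m = (\<integral>\<omega>. G (X \<omega>) \<partial>M) - G m"

definition bregman_region ::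
    "('w \<Rightarrow> 'v::real_vector \<Rightarrow> real) \<Rightarrow> 'a measure \<Rightarrow> ('v \<Rightarrow> real) \<Rightarrow> ('a \<Rightarrow> 'v) \<Rightarrow> 'v set \<Rightarrow> 'v \<Rightarrow> 'w \<Rightarrow> real
      \<Rightarrow> 'v set" where
  "bregman_region pair M G X S m g \<alpha> =
     {x \<in> S. bregman_div pair G g m x \<le> bregman_info M G X m / \<alpha>}"

text \<open>
  Since \<^term>\<open>measure M A = 0\<close> for non-measurable \<open>A\<close>, this includes measurability of the event
  that \<open>X\<close> lies in \<open>C\<close> whenever the level is positive.
\<close>

definition is_confidence_region :: "'a measure \<Rightarrow> ('a \<Rightarrow> 'v) \<Rightarrow> real \<Rightarrow> 'v set \<Rightarrow> bool" where
  "is_confidence_region M X lev C \<longleftrightarrow> measure M {\<omega> \<in> space M. X \<omega> \<in> C} \<ge> lev"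

end

(*
  The map x -> d_G(E X, x) is nonnegative because g is a subgradient at E X, and its expectation is
  the Bregman information because the linear term <g, X - E X> has mean zero. The claim is then
  Markov's inequality for d_G(E X, X).
*)
theory Submission
  imports Defs
begin

text \<open>The threshold is scaled so that Markov's inequality bounds the upper tail by exactly
  \<alpha>; the claim then follows by taking complements.\<close>

lemma (in prob_space) Markov_inequality_scaled_expectation:
  fixes Y :: "'a \<Rightarrow> real"
  assumes int: "integrable M Y" and nonneg: "AE \<omega> in M. 0 \<le> Y \<omega>" and "0 < \<alpha>"
  shows "prob {\<omega> \<in> space M. Y \<omega> \<le> expectation Y / \<alpha>} \<ge> 1 - \<alpha>"
proof -
  have [measurable]: "Y \<in> borel_measurable M"
    using int by simp
  have "0 \<le> expectation Y"
    using nonneg by (rule integral_nonneg_AE)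
  \<comment> \<open>Markov's inequality says nothing at threshold 0, so a vanishing expectation is separate.\<close>
  then consider "expectation Y = 0" | "0 < expectation Y"
    by linarith
  then show ?thesis
  proof cases
    case 1
    \<comment> \<open>An almost everywhere nonnegative function with integral 0 vanishes almost
      everywhere, and here the threshold is 0 too.\<close>
    then have "AE \<omega> in M. Y \<omega> \<le> expectation Y / \<alpha>"
      using integral_nonneg_eq_0_iff_AE[OF int nonneg] by auto
    then have "prob {\<omega> \<in> space M. Y \<omega> \<le> expectation Y / \<alpha>} = 1"
      by (intro prob_Collect_eq_1[THEN iffD2]) auto
    with \<open>0 < \<alpha>\<close> show ?thesis
      by simp
  next
    case 2
    \<comment> \<open>The complement is a strict tail, whereas Markov bounds the larger weak
      tail.\<close>
    have "prob {\<omega> \<in> space M. \<not> Y \<omega> \<le> expectation Y / \<alpha>}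
        \<le> prob {\<omega> \<in> space M. expectation Y / \<alpha> \<le> Y \<omega>}"
      by (intro finite_measure_mono) auto
    also have "\<dots> \<le> expectation Y / (expectation Y / \<alpha>)"
      using int nonneg 2 \<open>0 < \<alpha>\<close>
      by (intro integral_Markov_inequality_measure[where A = "{}"]) auto
    also have "\<dots> = \<alpha>"
      using 2 by simp
    finally show ?thesis
      by (subst (asm) prob_neg) auto
  qed
qed

lemma bregman_div_nonneg:
  assumes "is_subgradient pair U G x g" and "y \<in> U"
  shows "0 \<le> bregman_div pair G g x y"
  using assms by (auto simp: is_subgradient_def bregman_div_def)

lemma has_bochner_integral_bregman_div:
  fixes pair :: "'w::real_vector \<Rightarrow> 'v::real_vector \<Rightarrow> real"
  assumes "bilinear pair" and "prob_space M"
    and "has_weak_expectation pair M X m" and "integrable M (\<lambda>\<omega>. G (X \<omega>))"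
  shows "has_bochner_integral M (\<lambda>\<omega>. bregman_div pair G g m (X \<omega>)) (bregman_info M G X m)"
proof -
  interpret prob_space M by fact
  have lin: "integrable M (\<lambda>\<omega>. pair g (X \<omega>))" "pair g m = (\<integral>\<omega>. pair g (X \<omega>) \<partial>M)"
    using assms(3) by (auto simp: has_weak_expectation_def)
  \<comment> \<open>Splitting \<open>pair g (X \<omega> - m)\<close> isolates a difference with
    integral 0 by \<open>lin\<close>; the constants integrate to themselves under a probability
    measure.\<close>
  have "bregman_div pair G g m (X \<omega>) = G (X \<omega>) - G m - (pair g (X \<omega>) - pair g m)" for \<omega>
    by (simp add: bregman_div_def bilinear_rsub[OF assms(1)])
  then show ?thesis
    using assms(4) lin
    by (simp add: has_bochner_integral_iff bregman_info_def prob_space)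
qed

theorem mainTheorem7:
  fixes pair :: "'w::real_vector \<Rightarrow> 'v::real_vector \<Rightarrow> real"
    and U :: "'v set" and G :: "'v \<Rightarrow> real"
    and M :: "'a measure" and N :: "'v measure" and X :: "'a \<Rightarrow> 'v"
    and S :: "'v set" and m :: 'v and g :: 'w and \<alpha> :: real
  assumes "bilinear pair"
    and "convex U" and "convex_on U G"
    and "prob_space M"
    and "space N = U" and "X \<in> measurable M N"
    and "S \<subseteq> U" and "measure M {\<omega> \<in> space M. X \<omega> \<in> S} = 1"
    and "has_weak_expectation pair M X m" and "m \<in> U"
    and "integrable M (\<lambda>\<omega>. G (X \<omega>))"
    and "is_subgradient pair U G m g"
    and "0 < \<alpha>" and "\<alpha> < 1"
  shows "is_confidence_region M X (1 - \<alpha>) (bregman_region pair M G X S m g \<alpha>)"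
proof -
  interpret prob_space M by fact
  let ?D = "\<lambda>\<omega>. bregman_div pair G g m (X \<omega>)"
  have D: "integrable M ?D" "expectation ?D = bregman_info M G X m"
    using has_bochner_integral_bregman_div[OF assms(1,4,9,11)]
    by (auto simp: has_bochner_integral_iff)
  \<comment> \<open>Measurability comes from integrability: the sigma-algebra of \<open>N\<close> is
    not tied to \<open>G\<close> or to the pairing.\<close>
  have [measurable]: "?D \<in> borel_measurable M"
    using D(1) by simp
  \<comment> \<open>A non-measurable set would have \<open>measure\<close> 0 by default, so the
    value 1 forces measurability.\<close>
  have S: "{\<omega> \<in> space M. X \<omega> \<in> S} \<in> events"
    using assms(8) measure_notin_sets by fastforce
  \<comment> \<open>\<open>X\<close> maps \<open>space M\<close> into \<open>space N = U\<close>,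
    where the subgradient inequality applies.\<close>
  have "AE \<omega> in M. 0 \<le> ?D \<omega>"
    using assms(5) measurable_space[OF assms(6)] by (auto intro!: bregman_div_nonneg[OF assms(12)])
  from Markov_inequality_scaled_expectation[OF D(1) this assms(13)]
  have "1 - \<alpha> \<le> prob {\<omega> \<in> space M. ?D \<omega> \<le> bregman_info M G X m / \<alpha>}"
    by (simp add: D(2))
  \<comment> \<open>The region also demands membership in \<open>S\<close>, which holds almost
    surely, so the two events differ by a null set.\<close>
  also have "prob {\<omega> \<in> space M. ?D \<omega> \<le> bregman_info M G X m / \<alpha>}
      = prob {\<omega> \<in> space M. X \<omega> \<in> bregman_region pair M G X S m g \<alpha>}"
  proof (rule finite_measure_eq_AE)
    show "AE \<omega> in M. (\<omega> \<in> {\<omega> \<in> space M. ?D \<omega> \<le> bregman_info M G X m / \<alpha>}) =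
        (\<omega> \<in> {\<omega> \<in> space M. X \<omega> \<in> bregman_region pair M G X S m g \<alpha>})"
      using prob_Collect_eq_1[THEN iffD1, OF S assms(8)] by (auto simp: bregman_region_def)
    \<comment> \<open>Measurability is obtained in \<open>M\<close>, as an intersection of two
      events, rather than as the preimage of a measurable subset of \<open>U\<close>.\<close>
    have "{\<omega> \<in> space M. X \<omega> \<in> bregman_region pair M G X S m g \<alpha>} =
        {\<omega> \<in> space M. X \<omega> \<in> S} \<inter> {\<omega> \<in> space M. ?D \<omega> \<le> bregman_info M G X m / \<alpha>}"
      by (auto simp: bregman_region_def)
    with S show "{\<omega> \<in> space M. X \<omega> \<in> bregman_region pair M G X S m g \<alpha>} \<in> events"
      by simp
  qed measurable
  finally show ?thesis
    by (simp add: is_confidence_region_def)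
qed

end
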